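(* Let $n\ge2$ and let $\mathcal M$, $\mathcal N$, $\nu$ be as in the context. Then for every $a\in\mathcal M$ the sequence $\nu(a)$ is a one-column PBW-semistandard tableau, and the map $\tau:\mathcal M\to\mathcal N$, $a\mapsto b_{\nu(a)}$, is an isomorphism of posets.
   Context: $\mathcal M$ is the set of symbols $a_{i_1,\ldots,i_k}$, $1\le k\le n-1$, $1\le i_1<\dots<i_k\le n$, ordered by $a_{i_1,\ldots,i_k}\le a_{j_1,\ldots,j_l}$ iff $k\ge l$ and $i_r\le j_r$ for $1\le r\le l$. A one-column tableau $(\alpha_1,\ldots,\alpha_k)$ with entries in $[1,n]$ is PBW-semistandard if $\alpha_r\le k$ implies $\alpha_r=r$, and whenever $r_1<r_2$ with $\alpha_{r_1}>k$ and $\alpha_{r_2}>k$ we have $\alpha_{r_1}>\alpha_{r_2}$. A two-column tableau with columns $(\alpha_1,\ldots,\alpha_k)$ and $(\beta_1,\ldots,\beta_l)$ (in this order), $k\ge l$, is PBW-semistandard if both columns are and for every $r\in[1,l]$ there is $s\ge r$ with $\alpha_s\ge\beta_r$. $\mathcal N$ is the set of symbols $b_{\alpha_1,\ldots,\alpha_k}$, $1\le k\le n-1$, $(\alpha_1,\ldots,\alpha_k)$ a one-column PBW-semistandard tableau, ordered by $b_{\beta_1,\ldots,\beta_l}\le b_{\alpha_1,\ldots,\alpha_k}$ iff the two-column tableau with columns $(\alpha_1,\ldots,\alpha_k)$, $(\beta_1,\ldots,\beta_l)$ is PBW-semistandard. Let $P=\{(r,s):1\le r\le s\le n\}\setminus\{(1,1),(n,n)\}$;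 for $(r,s)\in P$ let $y_{r,s}=a_{\gamma_1,\ldots,\gamma_m}$ where $\{\gamma_1<\dots<\gamma_m\}=[1,n]\setminus[n-s+1,n+r-s]$. For $a\in\mathcal M$ let $J(a)=\{(r,s)\in P:y_{r,s}\le a\}$, let $\kappa$ be the largest $i$ with $(i,i)\in J(a)$ (and $\kappa=1$ if there is none), and let $(r_1,s_1),\ldots,(r_m,s_m)$ be the maximal elements of $J(a)$ (for the order $(r,s)\le(u,v)$ iff $r\le u$, $s\le v$) with $r_j<s_j$. Then $\nu(a)$ is the sequence obtained from $(1,2,\ldots,\kappa)$ by replacing each entry $r_j$ by $s_j$. *)

theory Defs
  imports Main
begin

text \<open>
  The symbols \<open>a\<^bsub>i\<^sub>1,\<dots>,i\<^sub>k\<^esub>\<close> and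
  \<open>b\<^bsub>\<alpha>\<^sub>1,\<dots>,\<alpha>\<^sub>k\<^esub>\<close> are identified with their
  index sequences, given as lists. Sequences are numbered from 1 in the mathematics and lists
  from 0, so \<open>entry\<close> provides the access used throughout.
\<close>

definition entry :: "nat list \<Rightarrow> nat \<Rightarrow> nat" where
  "entry xs r = xs ! (r - 1)"

definition M_set :: "nat \<Rightarrow> nat list set" where
  "M_set n = {a. 1 \<le> length a \<and> length a \<le> n - 1 \<and> set a \<subseteq> {1..n} \<and> sorted_wrt (<) a}"

definition M_le :: "nat list \<Rightarrow> nat list \<Rightarrow> bool" where
  "M_le a b \<longleftrightarrow> length b \<le> length a \<and> (\<forall>r\<in>{1..length b}. entry a r \<le> entry b r)"

definition pbw_column :: "nat \<Rightarrow> nat list \<Rightarrow> bool" where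
  "pbw_column n \<alpha> \<longleftrightarrow>
     set \<alpha> \<subseteq> {1..n} \<and>
     (\<forall>r\<in>{1..length \<alpha>}. entry \<alpha> r \<le> length \<alpha> \<longrightarrow> entry \<alpha> r = r) \<and>
     (\<forall>r1\<in>{1..length \<alpha>}. \<forall>r2\<in>{1..length \<alpha>}.
        r1 < r2 \<and> entry \<alpha> r1 > length \<alpha> \<and> entry \<alpha> r2 > length \<alpha>
          \<longrightarrow> entry \<alpha> r1 > entry \<alpha> r2)"

definition pbw_two_columns :: "nat \<Rightarrow> nat list \<Rightarrow> nat list \<Rightarrow> bool" where
  "pbw_two_columns n \<alpha> \<beta> \<longleftrightarrow>
     length \<beta> \<le> length \<alpha> \<and> pbw_column n \<alpha> \<and> pbw_column n \<beta> \<and>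
     (\<forall>r\<in>{1..length \<beta>}. \<exists>s\<in>{r..length \<alpha>}. entry \<alpha> s \<ge> entry \<beta> r)"

definition N_set :: "nat \<Rightarrow> nat list set" where
  "N_set n = {\<alpha>. 1 \<le> length \<alpha> \<and> length \<alpha> \<le> n - 1 \<and> pbw_column n \<alpha>}"

text \<open>The larger symbol is the left column.\<close>

definition N_le :: "nat \<Rightarrow> nat list \<Rightarrow> nat list \<Rightarrow> bool" where
  "N_le n \<beta> \<alpha> \<longleftrightarrow> pbw_two_columns n \<alpha> \<beta>"

definition M_ord :: "nat \<Rightarrow> nat list rel" where
  "M_ord n = {(a, b). a \<in> M_set n \<and> b \<in> M_set n \<and> M_le a b}"

definition N_ord :: "nat \<Rightarrow> nat list rel" where
  "N_ord n = {(a, b). a \<in> N_set n \<and> b \<in> N_set n \<and> N_le n a b}"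

definition P_set :: "nat \<Rightarrow> (nat \<times> nat) set" where
  "P_set n = {(r, s). 1 \<le> r \<and> r \<le> s \<and> s \<le> n} - {(1, 1), (n, n)}"

definition P_le :: "nat \<times> nat \<Rightarrow> nat \<times> nat \<Rightarrow> bool" where
  "P_le p q \<longleftrightarrow> fst p \<le> fst q \<and> snd p \<le> snd q"

definition y_elem :: "nat \<Rightarrow> nat \<Rightarrow> nat \<Rightarrow> nat list" where
  "y_elem n r s = sorted_list_of_set ({1..n} - {n - s + 1..n + r - s})"

definition J_set :: "nat \<Rightarrow> nat list \<Rightarrow> (nat \<times> nat) set" where
  "J_set n a = {(r, s). (r, s) \<in> P_set n \<and> M_le (y_elem n r s) a}"

definition kappa :: "nat \<Rightarrow> nat list \<Rightarrow> nat" where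
  "kappa n a =
     (if \<exists>i. (i, i) \<in> J_set n a then Max {i. (i, i) \<in> J_set n a} else 1)"

definition max_offdiag :: "nat \<Rightarrow> nat list \<Rightarrow> (nat \<times> nat) set" where
  "max_offdiag n a =
     {(r, s). (r, s) \<in> J_set n a \<and> (\<forall>q\<in>J_set n a. P_le (r, s) q \<longrightarrow> q = (r, s)) \<and> r < s}"

text \<open>
  Distinct maximal elements are incomparable, hence have distinct first components, so the
  definite description below is well defined.
\<close>

definition nu :: "nat \<Rightarrow> nat list \<Rightarrow> nat list" where
  "nu n a =
     map (\<lambda>i. if \<exists>s. (i, s) \<in> max_offdiag n a then THE s. (i, s) \<in> max_offdiag n a else i)
       [1..<kappa n a + 1]"

definition poset_iso :: "'a set \<Rightarrow> 'a rel \<Rightarrow> 'b set \<Rightarrow> 'b rel \<Rightarrow> ('a \<Rightarrow> 'b) \<Rightarrow> bool" where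
  "poset_iso A R B S f \<longleftrightarrow>
     partial_order_on A R \<and> partial_order_on B S \<and> bij_betw f A B \<and>
     (\<forall>x\<in>A. \<forall>y\<in>A. (x, y) \<in> R \<longleftrightarrow> (f x, f y) \<in> S)"

end

theory Submission
  imports Defs "HOL-Library.Product_Order"
begin

text \<open>
  Both posets are isomorphic to the set, ordered by inclusion, of the order ideals of the triangle
  \<open>{(r, s). 1 \<le> r \<le> s \<le> n}\<close> that contain \<open>(1, 1)\<close> but not \<open>(n, n)\<close>. On the \<open>\<M>\<close> side,
  encode \<open>a\<close> by the weakly increasing function \<open>j \<mapsto> a\<^sub>j - j\<close>, continued beyond the
  length \<open>k\<close> of \<open>a\<close> by the constant \<open>n - k\<close>. Then \<open>\<le>\<close> becomes the pointwise order and
  \<open>y\<^bsub>r,s\<^esub>\<close> becomes a step function, so \<open>y\<^bsub>r,s\<^esub> \<le> a\<close> just says that the value at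
  \<open>n - s + 1\<close> is at least \<open>r\<close>, and \<open>J(a)\<close> determines \<open>a\<close>. On the \<open>\<N>\<close> side, a
  column \<open>\<alpha>\<close> corresponds to the ideal generated by the points \<open>(t, \<alpha>\<^sub>t)\<close>, and the
  PBW-semistandard conditions say that \<open>\<alpha>\<close> is recovered from the maximal elements of this ideal
  by the recipe that defines \<open>\<nu>\<close>.
\<close>

section \<open>Poset isomorphisms\<close>

lemma poset_iso_relation_ofI:
  fixes f :: "'a \<Rightarrow> 'b::order"
  assumes bij: "bij_betw f A C"
    and le_iff: "\<And>x y. x \<in> A \<Longrightarrow> y \<in> A \<Longrightarrow> P x y \<longleftrightarrow> f x \<le> f y"
  shows "poset_iso A (relation_of P A) C (relation_of (\<le>) C) f"
proof -
  have "partial_order_on A (relation_of P A)"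
  proof (rule partial_order_on_relation_ofI)
    show "a = b" if "a \<in> A" "b \<in> A" "P a b" "P b a" for a b
      using that bij le_iff by (metis bij_betw_imp_inj_on inj_onD order_antisym)
  qed (use le_iff in \<open>auto intro: order_trans\<close>)
  moreover have "partial_order_on C (relation_of (\<le>) C)"
    by (rule partial_order_on_relation_ofI) auto
  ultimately show ?thesis
    using bij le_iff by (auto simp: poset_iso_def relation_of_def bij_betw_apply)
qed

lemma poset_iso_factor:
  assumes f: "poset_iso A R C T f" and g: "poset_iso B S C T g"
    and mem: "\<And>x. x \<in> A \<Longrightarrow> h x \<in> B" and factor: "\<And>x. x \<in> A \<Longrightarrow> g (h x) = f x"
  shows "poset_iso A R B S h"
proof -
  have bij: "bij_betw f A C" "bij_betw g B C"
    using f g by (simp_all add: poset_iso_def)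
  have "h x = inv_into B g (f x)" if "x \<in> A" for x
    using inv_into_f_f[OF bij_betw_imp_inj_on[OF bij(2)] mem[OF that]] factor[OF that] by simp
  then have "bij_betw h A B"
    using bij_betw_trans[OF bij(1) bij_betw_inv_into[OF bij(2)]]
    by (simp add: comp_def cong: bij_betw_cong)
  then show ?thesis
    using f g mem factor by (simp add: poset_iso_def)
qed

section \<open>Lists indexed from 1\<close>

lemma entry_in_set: "1 \<le> r \<Longrightarrow> r \<le> length xs \<Longrightarrow> entry xs r \<in> set xs"
  by (simp add: entry_def)

lemma in_set_conv_entry: "x \<in> set xs \<longleftrightarrow> (\<exists>r\<in>{1..length xs}. entry xs r = x)"
proof
  assume "x \<in> set xs"
  then obtain i where "i < length xs" "xs ! i = x"
    by (auto simp: in_set_conv_nth)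
  then show "\<exists>r\<in>{1..length xs}. entry xs r = x"
    by (intro bexI[of _ "Suc i"]) (auto simp: entry_def)
qed (auto intro: entry_in_set)

lemma list_eq_entryI:
  assumes "length xs = length ys"
    and "\<And>r. 1 \<le> r \<Longrightarrow> r \<le> length ys \<Longrightarrow> entry xs r = entry ys r"
  shows "xs = ys"
proof (rule nth_equalityI[OF assms(1)])
  fix i assume "i < length xs"
  then show "xs ! i = ys ! i"
    using assms(1) assms(2)[of "Suc i"] by (simp add: entry_def)
qed

lemma entry_map_upt:
  assumes "1 \<le> r" "r \<le> k"
  shows "entry (map f [1..<k + 1]) r = f r"
  using assms by (simp add: entry_def del: upt_Suc)

lemma sorted_wrt_less_entryI:
  assumes "\<And>i j. 1 \<le> i \<Longrightarrow> i < j \<Longrightarrow> j \<le> length xs \<Longrightarrow> entry xs i < entry xs j"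
  shows "sorted_wrt (<) xs"
  unfolding sorted_wrt_iff_nth_less
proof (intro allI impI)
  fix i j assume "i < j" "j < length xs"
  then show "xs ! i < xs ! j"
    using assms[of "Suc i" "Suc j"] by (simp add: entry_def)
qed

lemma sorted_wrt_less_entry_gap:
  assumes "sorted_wrt (<) a" "1 \<le> i" "i \<le> j" "j \<le> length a"
  shows "entry a i + j \<le> entry a j + i"
  using assms(3,4)
proof (induction j rule: dec_induct)
  case (step m)
  have "entry a m < entry a (Suc m)"
    using assms(1,2) step by (auto simp: entry_def intro: sorted_wrt_nth_less)
  then show ?case
    using step by auto
qed simp

section \<open>Proper ideals of the triangle\<close>

definition triangle :: "nat \<Rightarrow> (nat \<times> nat) set" where
  "triangle n = {(r, s). 1 \<le> r \<and> r \<le> s \<and> s \<le> n}"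

definition diag_length :: "(nat \<times> nat) set \<Rightarrow> nat" where
  "diag_length I = card {i. (i, i) \<in> I}"

definition row_height :: "(nat \<times> nat) set \<Rightarrow> nat \<Rightarrow> nat" where
  "row_height I s = card {r. (r, s) \<in> I}"

definition offdiag_corners :: "(nat \<times> nat) set \<Rightarrow> (nat \<times> nat) set" where
  "offdiag_corners I = {(r, s) \<in> I. r < s \<and> (\<forall>q\<in>I. (r, s) \<le> q \<longrightarrow> q = (r, s))}"

definition ideal_column :: "(nat \<times> nat) set \<Rightarrow> nat list" where
  "ideal_column I =
     map (\<lambda>r. if \<exists>s. (r, s) \<in> offdiag_corners I then THE s. (r, s) \<in> offdiag_corners I else r)
       [1..<diag_length I + 1]"

lemma length_ideal_column: "length (ideal_column I) = diag_length I"
  by (simp add: ideal_column_def del: upt_Suc)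

lemma offdiag_corners_row_unique:
  assumes "(r, s) \<in> offdiag_corners I" "(r, s') \<in> offdiag_corners I"
  shows "s = s'"
  using assms nat_le_linear[of s s'] by (auto simp: offdiag_corners_def)

lemma entry_ideal_column_corner:
  assumes "1 \<le> r" "r \<le> diag_length I" "(r, s) \<in> offdiag_corners I"
  shows "entry (ideal_column I) r = s"
proof -
  have "(THE s. (r, s) \<in> offdiag_corners I) = s"
    using assms(3) by (blast intro: offdiag_corners_row_unique)
  then show ?thesis
    using assms unfolding ideal_column_def by (subst entry_map_upt) auto
qed

lemma entry_ideal_column_no_corner:
  assumes "1 \<le> r" "r \<le> diag_length I" "\<nexists>s. (r, s) \<in> offdiag_corners I"
  shows "entry (ideal_column I) r = r"
  using assms unfolding ideal_column_def by (subst entry_map_upt) auto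

lemma down_closed_nat_set_eq:
  fixes X :: "nat set"
  assumes "finite X" "0 \<notin> X"
    and down: "\<And>x y. x \<in> X \<Longrightarrow> 1 \<le> y \<Longrightarrow> y \<le> x \<Longrightarrow> y \<in> X"
  shows "X = {1..card X}"
proof (cases "X = {}")
  case False
  have "X = {1..Max X}"
  proof (intro equalityI subsetI)
    fix x assume "x \<in> X"
    moreover from this have "x \<noteq> 0"
      using \<open>0 \<notin> X\<close> by metis
    ultimately show "x \<in> {1..Max X}"
      using \<open>finite X\<close> by simp
  next
    fix x assume "x \<in> {1..Max X}"
    then show "x \<in> X"
      using down[OF Max_in[OF \<open>finite X\<close> False]] by simp
  qed
  then show ?thesis
    by (metis card_atLeastAtMost diff_Suc_1)
qed simp

locale proper_ideal =
  fixes n :: nat and I :: "(nat \<times> nat) set"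
  assumes subset_triangle: "I \<subseteq> triangle n"
    and down_closed: "q \<in> I \<Longrightarrow> p \<in> triangle n \<Longrightarrow> p \<le> q \<Longrightarrow> p \<in> I"
    and bottom_mem: "(1, 1) \<in> I"
    and top_not_mem: "(n, n) \<notin> I"
begin

lemma memD:
  assumes "(r, s) \<in> I"
  shows "1 \<le> r" "r \<le> s" "s \<le> n"
  using assms subset_triangle by (auto simp: triangle_def)

lemma mem_leI:
  assumes "(u, v) \<in> I" "1 \<le> r" "r \<le> s" "r \<le> u" "s \<le> v"
  shows "(r, s) \<in> I"
  using down_closed[OF assms(1), of "(r, s)"] memD(3)[OF assms(1)] assms
  by (simp add: triangle_def)

lemma finite: "finite I"
proof (rule finite_subset)
  show "I \<subseteq> {1..n} \<times> {1..n}"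
    using memD by fastforce
qed simp

lemma section_mem_iff:
  assumes "\<And>x. fst (c x) = x"
    and "\<And>x y. c x \<in> I \<Longrightarrow> 1 \<le> y \<Longrightarrow> y \<le> x \<Longrightarrow> c y \<in> I"
  shows "c x \<in> I \<longleftrightarrow> 1 \<le> x \<and> x \<le> card {x. c x \<in> I}"
proof -
  have "{x. c x \<in> I} = {1..card {x. c x \<in> I}}"
  proof (rule down_closed_nat_set_eq)
    have "{x. c x \<in> I} \<subseteq> fst ` I"
      using assms(1) by (metis image_eqI mem_Collect_eq subsetI)
    then show "finite {x. c x \<in> I}"
      using finite by (blast intro: finite_surj)
    show "0 \<notin> {x. c x \<in> I}"
      using assms(1)[of 0] memD(1)[of 0 "snd (c 0)"] by (cases "c 0") auto
  qed (use assms(2) in simp)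
  then show ?thesis
    by auto
qed

lemma row_mem_iff: "(r, s) \<in> I \<longleftrightarrow> 1 \<le> r \<and> r \<le> row_height I s"
  unfolding row_height_def
proof (rule section_mem_iff)
  show "(y, s) \<in> I" if "(x, s) \<in> I" "1 \<le> y" "y \<le> x" for x y
    using that memD(2)[OF that(1)] by (elim mem_leI) auto
qed simp

lemma diag_mem_iff: "(i, i) \<in> I \<longleftrightarrow> 1 \<le> i \<and> i \<le> diag_length I"
  unfolding diag_length_def
proof (rule section_mem_iff)
  show "(y, y) \<in> I" if "(x, x) \<in> I" "1 \<le> y" "y \<le> x" for x y
    using that by (elim mem_leI) auto
qed simp

lemma diag_length_ge_1: "1 \<le> diag_length I"
  using bottom_mem diag_mem_iff by simp

lemma diag_length_mem: "(diag_length I, diag_length I) \<in> I"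
  using diag_length_ge_1 diag_mem_iff by simp

lemma diag_length_less: "diag_length I < n"
  using diag_length_mem memD(3) top_not_mem by (metis le_neq_implies_less)

lemma fst_le_diag_length:
  assumes "(r, s) \<in> I"
  shows "r \<le> diag_length I"
  using mem_leI[OF assms, of r r] memD[OF assms] diag_mem_iff by simp

lemma row_height_le_diag_length: "row_height I s \<le> diag_length I"
  using row_mem_iff[of "row_height I s" s] fst_le_diag_length[of "row_height I s" s]
  by (cases "row_height I s = 0") auto

lemma row_height_antimono:
  assumes "diag_length I \<le> s" "s \<le> s'"
  shows "row_height I s' \<le> row_height I s"
proof (cases "row_height I s' = 0")
  case False
  then have "(row_height I s', s') \<in> I"
    by (simp add: row_mem_iff)
  then have "(row_height I s', s) \<in> I"
    using assms False row_height_le_diag_length[of s'] by (elim mem_leI) auto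
  then show ?thesis
    by (simp add: row_mem_iff)
qed simp

lemma offdiag_cornerD:
  assumes "(r, s) \<in> offdiag_corners I"
  shows "1 \<le> r" "r \<le> diag_length I" "diag_length I < s" "entry (ideal_column I) r = s"
proof -
  have rs: "(r, s) \<in> I" "r < s"
    and maximal: "\<And>q. q \<in> I \<Longrightarrow> (r, s) \<le> q \<Longrightarrow> q = (r, s)"
    using assms by (auto simp: offdiag_corners_def)
  show r: "1 \<le> r" "r \<le> diag_length I"
    using rs(1) memD(1) fst_le_diag_length by auto
  show "diag_length I < s"
    using maximal[OF diag_length_mem] r rs(2) by fastforce
  show "entry (ideal_column I) r = s"
    using r assms by (rule entry_ideal_column_corner)
qed

lemma ideal_column_cases:
  assumes "1 \<le> r" "r \<le> diag_length I"
  obtains (corner) "(r, entry (ideal_column I) r) \<in> offdiag_corners I"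
      "diag_length I < entry (ideal_column I) r"
    | (diagonal) "entry (ideal_column I) r = r"
proof (cases "\<exists>s. (r, s) \<in> offdiag_corners I")
  case True
  then obtain s where "(r, s) \<in> offdiag_corners I" ..
  then show ?thesis
    using corner offdiag_cornerD(3,4) by simp
next
  case False
  then show ?thesis
    using diagonal entry_ideal_column_no_corner[OF assms] by simp
qed

lemma ideal_column_entry_mem:
  assumes "1 \<le> r" "r \<le> diag_length I"
  shows "(r, entry (ideal_column I) r) \<in> I"
  using assms
proof (cases rule: ideal_column_cases)
  case corner
  then show ?thesis
    by (simp add: offdiag_corners_def)
next
  case diagonal
  then show ?thesis
    using assms by (simp add: diag_mem_iff)
qed

lemma pbw_column_ideal_column: "pbw_column n (ideal_column I)"
proof -
  let ?\<alpha> = "ideal_column I" and ?k = "diag_length I"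
  have "set ?\<alpha> \<subseteq> {1..n}"
  proof
    fix x assume "x \<in> set ?\<alpha>"
    then obtain r where "1 \<le> r" "r \<le> ?k" "x = entry ?\<alpha> r"
      by (auto simp: in_set_conv_entry length_ideal_column)
    then show "x \<in> {1..n}"
      using memD[OF ideal_column_entry_mem[of r]] by simp
  qed
  moreover have "entry ?\<alpha> r = r" if "1 \<le> r" "r \<le> ?k" "entry ?\<alpha> r \<le> ?k" for r
    using that(1,2) by (cases rule: ideal_column_cases) (use that(3) in auto)
  moreover have "entry ?\<alpha> u < entry ?\<alpha> r"
    if "1 \<le> r" "r < u" "u \<le> ?k" "?k < entry ?\<alpha> r" "?k < entry ?\<alpha> u" for r u
  proof -
    have corner: "(i, entry ?\<alpha> i) \<in> offdiag_corners I"
      if "1 \<le> i" "i \<le> ?k" "?k < entry ?\<alpha> i" for i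
      using that(1,2) by (cases rule: ideal_column_cases) (use that in auto)
    have "\<not> (r, entry ?\<alpha> r) \<le> (u, entry ?\<alpha> u)"
      using corner[of r] corner[of u] that by (auto simp: offdiag_corners_def)
    then show ?thesis
      using that by simp
  qed
  ultimately show ?thesis
    by (simp add: pbw_column_def length_ideal_column)
qed

lemma ideal_column_in_N_set: "ideal_column I \<in> N_set n"
  using pbw_column_ideal_column diag_length_ge_1 diag_length_less
  by (simp add: N_set_def length_ideal_column)

end

abbreviation proper_ideals :: "nat \<Rightarrow> (nat \<times> nat) set set" where
  "proper_ideals n \<equiv> Collect (proper_ideal n)"

section \<open>The ideal of an increasing sequence\<close>

definition strict_seq :: "nat \<Rightarrow> nat list \<Rightarrow> bool" where
  "strict_seq n a \<longleftrightarrow> sorted_wrt (<) a \<and> set a \<subseteq> {1..n}"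

definition excess :: "nat \<Rightarrow> nat list \<Rightarrow> nat \<Rightarrow> nat" where
  "excess n a j = (if j \<le> length a then entry a j - j else n - length a)"

definition M_ideal :: "nat \<Rightarrow> nat list \<Rightarrow> (nat \<times> nat) set" where
  "M_ideal n a = {(r, s) \<in> triangle n. M_le (y_elem n r s) a}"

definition ideal_seq :: "nat \<Rightarrow> (nat \<times> nat) set \<Rightarrow> nat list" where
  "ideal_seq n I = map (\<lambda>j. j + row_height I (Suc (n - j))) [1..<(n - diag_length I) + 1]"

lemma M_set_iff: "a \<in> M_set n \<longleftrightarrow> strict_seq n a \<and> 1 \<le> length a \<and> length a < n"
  by (auto simp: M_set_def strict_seq_def)

lemma strict_seq_entry_bounds:
  assumes "strict_seq n a" "1 \<le> j" "j \<le> length a"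
  shows "j \<le> entry a j" "entry a j + length a \<le> n + j"
proof -
  have "entry a 1 + j \<le> entry a j + 1" "entry a j + length a \<le> entry a (length a) + j"
    using assms sorted_wrt_less_entry_gap[of a 1 j] sorted_wrt_less_entry_gap[of a j "length a"]
    by (simp_all add: strict_seq_def)
  moreover have "1 \<le> entry a 1" "entry a (length a) \<le> n"
    using assms entry_in_set[of 1 a] entry_in_set[of "length a" a] by (auto simp: strict_seq_def)
  ultimately show "j \<le> entry a j" "entry a j + length a \<le> n + j"
    by simp_all
qed

lemma strict_seq_length_le:
  assumes "strict_seq n a"
  shows "length a \<le> n"
  using strict_seq_entry_bounds[OF assms, of 1] strict_seq_entry_bounds[OF assms, of "length a"]
  by (cases a) (auto simp: entry_def)

lemma entry_eq_excess:
  assumes "strict_seq n a" "1 \<le> j" "j \<le> length a"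
  shows "entry a j = j + excess n a j"
  using strict_seq_entry_bounds(1)[OF assms] assms(3) by (simp add: excess_def)

lemma excess_le:
  assumes "strict_seq n a" "1 \<le> j"
  shows "excess n a j \<le> n - length a"
  using strict_seq_entry_bounds(2)[OF assms] by (cases "j \<le> length a") (auto simp: excess_def)

lemma excess_mono:
  assumes a: "strict_seq n a" and ij: "1 \<le> i" "i \<le> j"
  shows "excess n a i \<le> excess n a j"
proof (cases "j \<le> length a")
  case True
  then show ?thesis
    using a ij sorted_wrt_less_entry_gap[of a i j] by (simp add: strict_seq_def excess_def)
next
  case False
  then show ?thesis
    using excess_le[OF a ij(1)] by (simp add: excess_def)
qed

lemma M_le_iff_excess_le:
  assumes a: "strict_seq n a" and b: "strict_seq n b"
  shows "M_le a b \<longleftrightarrow> (\<forall>j\<ge>1. excess n a j \<le> excess n b j)"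
proof (intro iffI allI impI)
  fix j :: nat assume le: "M_le a b" and j: "1 \<le> j"
  then have len: "length b \<le> length a"
    by (simp add: M_le_def)
  show "excess n a j \<le> excess n b j"
  proof (cases "j \<le> length b")
    case True
    then show ?thesis
      using le len j by (simp add: M_le_def excess_def diff_le_mono)
  next
    case False
    then show ?thesis
      using excess_le[OF a j] len by (simp add: excess_def)
  qed
next
  assume le: "\<forall>j\<ge>1. excess n a j \<le> excess n b j"
  have len: "length b \<le> length a"
    using le[rule_format, of "n + 1"] strict_seq_length_le[OF a] strict_seq_length_le[OF b]
    by (simp add: excess_def)
  moreover have "entry a j \<le> entry b j" if "1 \<le> j" "j \<le> length b" for j
    using that len le entry_eq_excess[OF a, of j] entry_eq_excess[OF b, of j] by simp
  ultimately show "M_le a b"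
    by (simp add: M_le_def)
qed

lemma M_le_antisym:
  assumes "M_le a b" "M_le b a"
  shows "a = b"
  using assms by (intro list_eq_entryI) (auto simp: M_le_def intro: le_antisym)

lemma strict_seq_y_elem: "strict_seq n (y_elem n r s)"
  by (auto simp: strict_seq_def y_elem_def)

lemma y_elem_eq:
  assumes "(r, s) \<in> triangle n"
  shows "y_elem n r s = [1..<n - s + 1] @ [n + r - s + 1..<n + 1]"
proof -
  let ?l = "[1..<n - s + 1] @ [n + r - s + 1..<n + 1]"
  have "set ?l = {1..n} - {n - s + 1..n + r - s}"
    using assms by (auto simp: triangle_def)
  moreover have "sorted ?l" "distinct ?l"
    using assms by (auto simp: triangle_def sorted_append)
  ultimately show ?thesis
    unfolding y_elem_def by (metis sorted_list_of_set.idem_if_sorted_distinct)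
qed

lemma excess_y_elem:
  assumes rs: "(r, s) \<in> triangle n" and j: "1 \<le> j"
  shows "excess n (y_elem n r s) j = (if j \<le> n - s then 0 else r)"
proof -
  have len: "length (y_elem n r s) = n - r"
    using rs by (simp add: y_elem_eq triangle_def del: upt_Suc)
  consider "j \<le> n - s" | "n - s < j" "j \<le> n - r" | "n - r < j"
    by linarith
  then show ?thesis
    using rs j
    by cases
      (auto simp: excess_def len y_elem_eq triangle_def entry_def nth_append simp del: upt_Suc)
qed

lemma y_elem_le_iff:
  assumes rs: "(r, s) \<in> triangle n" and a: "strict_seq n a"
  shows "M_le (y_elem n r s) a \<longleftrightarrow> r \<le> excess n a (Suc (n - s))"
proof -
  have "M_le (y_elem n r s) a \<longleftrightarrow> (\<forall>j\<ge>Suc (n - s). r \<le> excess n a j)"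
    unfolding M_le_iff_excess_le[OF strict_seq_y_elem a]
    by (auto simp: excess_y_elem[OF rs])
  also have "\<dots> \<longleftrightarrow> r \<le> excess n a (Suc (n - s))"
    using excess_mono[OF a, of "Suc (n - s)"] by (auto intro: le_trans)
  finally show ?thesis .
qed

lemma M_ideal_mem_iff:
  assumes "strict_seq n a"
  shows "(r, s) \<in> M_ideal n a \<longleftrightarrow> (r, s) \<in> triangle n \<and> r \<le> excess n a (Suc (n - s))"
  using y_elem_le_iff[OF _ assms] by (auto simp: M_ideal_def)

lemma proper_ideal_M_ideal:
  assumes "a \<in> M_set n"
  shows "proper_ideal n (M_ideal n a)"
proof
  have a: "strict_seq n a" "1 \<le> length a" "length a < n"
    using assms by (simp_all add: M_set_iff)
  show "M_ideal n a \<subseteq> triangle n"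
    by (auto simp: M_ideal_def)
  show "(1, 1) \<in> M_ideal n a"
    using a by (simp add: M_ideal_mem_iff triangle_def excess_def)
  show "(n, n) \<notin> M_ideal n a"
    using excess_le[OF a(1), of 1] a by (auto simp: M_ideal_mem_iff)
  fix p q assume pq: "q \<in> M_ideal n a" "p \<in> triangle n" "p \<le> q"
  obtain r s u v where [simp]: "p = (r, s)" "q = (u, v)"
    by fastforce
  have "r \<le> u"
    using pq by simp
  also have "u \<le> excess n a (Suc (n - v))"
    using pq a by (simp add: M_ideal_mem_iff)
  also have "\<dots> \<le> excess n a (Suc (n - s))"
    using pq a by (intro excess_mono) (simp_all add: diff_le_mono2)
  finally show "p \<in> M_ideal n a"
    using pq a by (simp add: M_ideal_mem_iff)
qed

lemma excess_mem_M_ideal: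
  assumes a: "strict_seq n a" and i: "1 \<le> i" "i \<le> length a + 1" and pos: "0 < excess n a i"
  shows "(excess n a i, Suc (n - i)) \<in> M_ideal n a"
proof -
  have "excess n a i \<le> n - length a"
    using excess_le[OF a i(1)] .
  then have "(excess n a i, Suc (n - i)) \<in> triangle n" "Suc (n - Suc (n - i)) = i"
    using i pos by (auto simp: triangle_def)
  then show ?thesis
    by (simp add: M_ideal_mem_iff[OF a])
qed

lemma M_le_iff_M_ideal_subset:
  assumes a: "strict_seq n a" and b: "strict_seq n b"
  shows "M_le a b \<longleftrightarrow> M_ideal n a \<subseteq> M_ideal n b"
proof
  assume le: "M_le a b"
  show "M_ideal n a \<subseteq> M_ideal n b"
  proof (rule subrelI)
    fix r s assume "(r, s) \<in> M_ideal n a"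
    moreover have "excess n a (Suc (n - s)) \<le> excess n b (Suc (n - s))"
      using le by (simp add: M_le_iff_excess_le[OF a b])
    ultimately show "(r, s) \<in> M_ideal n b"
      by (simp add: M_ideal_mem_iff a b)
  qed
next
  assume subset: "M_ideal n a \<subseteq> M_ideal n b"
  have "excess n a j \<le> excess n b j" if j: "1 \<le> j" for j
  proof (cases "excess n a j = 0")
    case False
    define i where "i = min j (length a + 1)"
    have i: "1 \<le> i" "i \<le> j" "i \<le> length a + 1" "excess n a j = excess n a i"
      using j by (auto simp: i_def excess_def)
    have "i \<le> n"
      using excess_le[OF a i(1)] i False by simp
    then have "excess n a i \<le> excess n b i"
      using subset excess_mem_M_ideal[OF a i(1,3)] i(1,4) False
      by (auto simp: M_ideal_mem_iff[OF b])
    also have "\<dots> \<le> excess n b j"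
      using i by (intro excess_mono[OF b])
    finally show ?thesis
      using i by simp
  qed simp
  then show "M_le a b"
    by (simp add: M_le_iff_excess_le[OF a b])
qed

context proper_ideal
begin

lemma length_ideal_seq: "length (ideal_seq n I) = n - diag_length I"
  by (simp add: ideal_seq_def del: upt_Suc)

lemma entry_ideal_seq:
  assumes "1 \<le> j" "j \<le> n - diag_length I"
  shows "entry (ideal_seq n I) j = j + row_height I (Suc (n - j))"
  using assms unfolding ideal_seq_def by (rule entry_map_upt)

lemma ideal_seq_in_M_set: "ideal_seq n I \<in> M_set n"
proof -
  let ?k = "diag_length I"
  have "sorted_wrt (<) (ideal_seq n I)"
  proof (rule sorted_wrt_less_entryI)
    fix i j assume ij: "1 \<le> i" "i < j" "j \<le> length (ideal_seq n I)"
    then have "row_height I (Suc (n - i)) \<le> row_height I (Suc (n - j))"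
      by (intro row_height_antimono) (auto simp: length_ideal_seq)
    then show "entry (ideal_seq n I) i < entry (ideal_seq n I) j"
      using ij by (simp add: entry_ideal_seq length_ideal_seq)
  qed
  moreover have "j + row_height I (Suc (n - j)) \<in> {1..n}" if "1 \<le> j" "j \<le> n - ?k" for j
    using that row_height_le_diag_length[of "Suc (n - j)"] diag_length_less by simp
  then have "set (ideal_seq n I) \<subseteq> {1..n}"
    by (auto simp: in_set_conv_entry length_ideal_seq entry_ideal_seq)
  ultimately show ?thesis
    using diag_length_ge_1 diag_length_less by (simp add: M_set_iff strict_seq_def length_ideal_seq)
qed

lemma excess_ideal_seq:
  assumes "1 \<le> s" "s \<le> n"
  shows "excess n (ideal_seq n I) (Suc (n - s)) =
    (if s \<le> diag_length I then diag_length I else row_height I s)"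
  using assms diag_length_less by (auto simp: excess_def length_ideal_seq entry_ideal_seq)

lemma M_ideal_ideal_seq: "M_ideal n (ideal_seq n I) = I"
proof -
  have "(r, s) \<in> M_ideal n (ideal_seq n I) \<longleftrightarrow> (r, s) \<in> I" if rs: "(r, s) \<in> triangle n" for r s
  proof (cases "s \<le> diag_length I")
    case True
    then show ?thesis
      using rs ideal_seq_in_M_set mem_leI[OF diag_length_mem, of r s]
      by (simp add: M_ideal_mem_iff M_set_iff excess_ideal_seq triangle_def)
  next
    case False
    then show ?thesis
      using rs ideal_seq_in_M_set
      by (simp add: M_ideal_mem_iff M_set_iff excess_ideal_seq triangle_def row_mem_iff)
  qed
  then show ?thesis
    using subset_triangle by (fastforce simp: M_ideal_def)
qed

end

lemma bij_betw_M_ideal: "bij_betw (M_ideal n) (M_set n) (proper_ideals n)"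
proof (rule bij_betw_imageI)
  show "inj_on (M_ideal n) (M_set n)"
    by (intro inj_onI M_le_antisym) (simp_all add: M_set_iff M_le_iff_M_ideal_subset[of n])
  show "M_ideal n ` M_set n = proper_ideals n"
  proof (intro equalityI subsetI)
    fix I assume "I \<in> proper_ideals n"
    then have "I = M_ideal n (ideal_seq n I)" "ideal_seq n I \<in> M_set n"
      by (simp_all add: proper_ideal.M_ideal_ideal_seq proper_ideal.ideal_seq_in_M_set)
    then show "I \<in> M_ideal n ` M_set n"
      by (rule image_eqI)
  qed (auto intro: proper_ideal_M_ideal)
qed

lemma poset_iso_M_ideal:
  "poset_iso (M_set n) (M_ord n) (proper_ideals n) (relation_of (\<subseteq>) (proper_ideals n))
    (M_ideal n)"
proof -
  have "M_ord n = relation_of M_le (M_set n)"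
    by (auto simp: M_ord_def relation_of_def)
  then show ?thesis
    using poset_iso_relation_ofI[OF bij_betw_M_ideal]
    by (simp add: M_set_iff M_le_iff_M_ideal_subset[of n])
qed

section \<open>The ideal of a PBW-semistandard column\<close>

definition N_ideal :: "nat \<Rightarrow> nat list \<Rightarrow> (nat \<times> nat) set" where
  "N_ideal n \<alpha> = {(r, s) \<in> triangle n. \<exists>t\<in>{r..length \<alpha>}. s \<le> entry \<alpha> t}"

lemma pbw_column_small_entry:
  assumes "pbw_column n \<alpha>" "1 \<le> r" "r \<le> length \<alpha>" "entry \<alpha> r \<le> length \<alpha>"
  shows "entry \<alpha> r = r"
  using assms by (simp add: pbw_column_def)

lemma pbw_column_entry_bounds:
  assumes "pbw_column n \<alpha>" "1 \<le> r" "r \<le> length \<alpha>"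
  shows "r \<le> entry \<alpha> r" "entry \<alpha> r \<le> n"
proof -
  show "r \<le> entry \<alpha> r"
    using assms(3) pbw_column_small_entry[OF assms] by (cases "entry \<alpha> r \<le> length \<alpha>") auto
  show "entry \<alpha> r \<le> n"
    using assms entry_in_set[of r \<alpha>] by (auto simp: pbw_column_def)
qed

lemma pbw_column_large_entry_le_imp_eq:
  assumes "pbw_column n \<alpha>" "1 \<le> r" "r \<le> t" "t \<le> length \<alpha>"
    and "length \<alpha> < entry \<alpha> r" "entry \<alpha> r \<le> entry \<alpha> t"
  shows "t = r"
proof (rule ccontr)
  assume "t \<noteq> r"
  then have "entry \<alpha> t < entry \<alpha> r"
    using assms by (auto simp: pbw_column_def)
  then show False
    using assms(6) by simp
qed

lemma entry_mem_N_ideal: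
  assumes "pbw_column n \<alpha>" "1 \<le> t" "t \<le> length \<alpha>"
  shows "(t, entry \<alpha> t) \<in> N_ideal n \<alpha>"
  using pbw_column_entry_bounds[OF assms] assms by (auto simp: N_ideal_def triangle_def)

lemma proper_ideal_N_ideal:
  assumes "\<alpha> \<in> N_set n"
  shows "proper_ideal n (N_ideal n \<alpha>)"
proof
  have \<alpha>: "pbw_column n \<alpha>" "1 \<le> length \<alpha>" "length \<alpha> < n"
    using assms by (auto simp: N_set_def)
  show "N_ideal n \<alpha> \<subseteq> triangle n"
    by (auto simp: N_ideal_def)
  show "(1, 1) \<in> N_ideal n \<alpha>"
    using \<alpha> pbw_column_entry_bounds(1)[OF \<alpha>(1), of 1] by (force simp: N_ideal_def triangle_def)
  show "(n, n) \<notin> N_ideal n \<alpha>"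
    using \<alpha> by (auto simp: N_ideal_def)
  fix p q assume pq: "q \<in> N_ideal n \<alpha>" "p \<in> triangle n" "p \<le> q"
  obtain r s u v where [simp]: "p = (r, s)" "q = (u, v)"
    by fastforce
  obtain t where "u \<le> t" "t \<le> length \<alpha>" "v \<le> entry \<alpha> t"
    using pq(1) by (auto simp: N_ideal_def)
  then have "t \<in> {r..length \<alpha>}" "s \<le> entry \<alpha> t"
    using pq(3) by auto
  then show "p \<in> N_ideal n \<alpha>"
    using pq(2) by (auto simp: N_ideal_def)
qed

lemma N_le_iff_N_ideal_subset:
  assumes "\<alpha> \<in> N_set n" "\<beta> \<in> N_set n"
  shows "N_le n \<beta> \<alpha> \<longleftrightarrow> N_ideal n \<beta> \<subseteq> N_ideal n \<alpha>"
proof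
  assume "N_le n \<beta> \<alpha>"
  then have dominated: "\<exists>u\<in>{t..length \<alpha>}. entry \<beta> t \<le> entry \<alpha> u"
    if "1 \<le> t" "t \<le> length \<beta>" for t
    using that by (simp add: N_le_def pbw_two_columns_def)
  show "N_ideal n \<beta> \<subseteq> N_ideal n \<alpha>"
  proof (rule subrelI)
    fix r s assume rs: "(r, s) \<in> N_ideal n \<beta>"
    then obtain t where t: "1 \<le> r" "r \<le> t" "t \<le> length \<beta>" "s \<le> entry \<beta> t"
      by (auto simp: N_ideal_def triangle_def)
    then obtain u where "t \<le> u" "u \<le> length \<alpha>" "entry \<beta> t \<le> entry \<alpha> u"
      using dominated[of t] by auto
    then have "u \<in> {r..length \<alpha>}" "s \<le> entry \<alpha> u"
      using t by auto
    then show "(r, s) \<in> N_ideal n \<alpha>"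
      using rs by (auto simp: N_ideal_def)
  qed
next
  assume subset: "N_ideal n \<beta> \<subseteq> N_ideal n \<alpha>"
  have columns: "pbw_column n \<alpha>" "pbw_column n \<beta>" "1 \<le> length \<beta>"
    using assms by (auto simp: N_set_def)
  have dominated: "\<exists>s\<in>{r..length \<alpha>}. entry \<beta> r \<le> entry \<alpha> s"
    if "1 \<le> r" "r \<le> length \<beta>" for r
    using subset entry_mem_N_ideal[OF columns(2) that] by (auto simp: N_ideal_def)
  moreover have "length \<beta> \<le> length \<alpha>"
    using dominated[OF columns(3)] by auto
  ultimately show "N_le n \<beta> \<alpha>"
    using columns by (simp add: N_le_def pbw_two_columns_def)
qed

lemma diag_length_N_ideal:
  assumes "\<alpha> \<in> N_set n"
  shows "diag_length (N_ideal n \<alpha>) = length \<alpha>"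
proof -
  have "(i, i) \<in> N_ideal n \<alpha> \<longleftrightarrow> i \<in> {1..length \<alpha>}" for i
    using assms pbw_column_entry_bounds(1)[of n \<alpha> i]
    by (fastforce simp: N_ideal_def triangle_def N_set_def)
  then have "{i. (i, i) \<in> N_ideal n \<alpha>} = {1..length \<alpha>}"
    by blast
  then show ?thesis
    by (simp add: diag_length_def)
qed

lemma offdiag_corners_N_ideal:
  assumes \<alpha>: "pbw_column n \<alpha>"
  shows "(r, s) \<in> offdiag_corners (N_ideal n \<alpha>) \<longleftrightarrow>
    1 \<le> r \<and> r \<le> length \<alpha> \<and> length \<alpha> < s \<and> s = entry \<alpha> r"
proof
  assume corner: "(r, s) \<in> offdiag_corners (N_ideal n \<alpha>)"
  then obtain t where t: "1 \<le> r" "r \<le> t" "t \<le> length \<alpha>" "s \<le> entry \<alpha> t"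
    by (auto simp: offdiag_corners_def N_ideal_def triangle_def)
  then have "(t, entry \<alpha> t) = (r, s)"
    using corner entry_mem_N_ideal[OF \<alpha>, of t] by (auto simp: offdiag_corners_def)
  then have "s = entry \<alpha> r" "r \<le> length \<alpha>"
    using t by auto
  moreover have "r < s"
    using corner by (simp add: offdiag_corners_def)
  ultimately show "1 \<le> r \<and> r \<le> length \<alpha> \<and> length \<alpha> < s \<and> s = entry \<alpha> r"
    using t pbw_column_small_entry[OF \<alpha>, of r] by fastforce
next
  assume rs: "1 \<le> r \<and> r \<le> length \<alpha> \<and> length \<alpha> < s \<and> s = entry \<alpha> r"
  have "(u, v) = (r, s)" if uv: "(u, v) \<in> N_ideal n \<alpha>" "(r, s) \<le> (u, v)" for u v
  proof -
    obtain t where t: "u \<le> t" "t \<le> length \<alpha>" "v \<le> entry \<alpha> t"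
      using uv by (auto simp: N_ideal_def)
    then have "t = r"
      using rs uv by (intro pbw_column_large_entry_le_imp_eq[OF \<alpha>]) auto
    then show ?thesis
      using t rs uv by auto
  qed
  then show "(r, s) \<in> offdiag_corners (N_ideal n \<alpha>)"
    using rs entry_mem_N_ideal[OF \<alpha>, of r] by (auto simp: offdiag_corners_def)
qed

lemma ideal_column_N_ideal:
  assumes "\<alpha> \<in> N_set n"
  shows "ideal_column (N_ideal n \<alpha>) = \<alpha>"
proof (rule list_eq_entryI)
  have \<alpha>: "pbw_column n \<alpha>"
    using assms by (simp add: N_set_def)
  note len = diag_length_N_ideal[OF assms]
  show "length (ideal_column (N_ideal n \<alpha>)) = length \<alpha>"
    by (simp add: length_ideal_column len)
  fix r assume r: "1 \<le> r" "r \<le> length \<alpha>"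
  show "entry (ideal_column (N_ideal n \<alpha>)) r = entry \<alpha> r"
  proof (cases "length \<alpha> < entry \<alpha> r")
    case True
    then show ?thesis
      using r by (intro entry_ideal_column_corner)
        (simp_all add: len offdiag_corners_N_ideal[OF \<alpha>])
  next
    case False
    then have "entry (ideal_column (N_ideal n \<alpha>)) r = r"
      using r by (intro entry_ideal_column_no_corner)
        (auto simp: len offdiag_corners_N_ideal[OF \<alpha>])
    then show ?thesis
      using False pbw_column_small_entry[OF \<alpha> r] by simp
  qed
qed

lemma (in proper_ideal) N_ideal_ideal_column: "N_ideal n (ideal_column I) = I"
proof (intro equalityI subrelI)
  fix r s assume "(r, s) \<in> N_ideal n (ideal_column I)"
  then obtain t where "1 \<le> r" "r \<le> s" "r \<le> t" "t \<le> diag_length I" "s \<le> entry (ideal_column I) t"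
    by (auto simp: N_ideal_def triangle_def length_ideal_column)
  then show "(r, s) \<in> I"
    using mem_leI[OF ideal_column_entry_mem[of t]] by simp
next
  fix r s assume rs: "(r, s) \<in> I"
  obtain u v where uv: "(u, v) \<in> I" "r \<le> u" "s \<le> v"
    and maximal: "\<forall>q\<in>I. (u, v) \<le> q \<longrightarrow> q = (u, v)"
    using finite_has_maximal2[OF finite rs] by fastforce
  have u: "1 \<le> u" "u \<le> diag_length I"
    using memD(1) fst_le_diag_length uv(1) by auto
  have "v \<le> entry (ideal_column I) u"
  proof (cases "u < v")
    case True
    then have "(u, v) \<in> offdiag_corners I"
      using uv(1) maximal by (simp add: offdiag_corners_def)
    then show ?thesis
      by (simp add: offdiag_cornerD(4))
  next
    case False
    then show ?thesis
      using pbw_column_entry_bounds(1)[OF pbw_column_ideal_column, of u] u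
      by (simp add: length_ideal_column)
  qed
  then have "u \<in> {r..length (ideal_column I)}" "s \<le> entry (ideal_column I) u"
    using uv u by (auto simp: length_ideal_column)
  then show "(r, s) \<in> N_ideal n (ideal_column I)"
    using rs subset_triangle by (auto simp: N_ideal_def)
qed

lemma bij_betw_N_ideal: "bij_betw (N_ideal n) (N_set n) (proper_ideals n)"
  by (rule bij_betw_byWitness[where f' = ideal_column])
    (auto simp: ideal_column_N_ideal proper_ideal_N_ideal proper_ideal.N_ideal_ideal_column
      proper_ideal.ideal_column_in_N_set)

lemma poset_iso_N_ideal:
  "poset_iso (N_set n) (N_ord n) (proper_ideals n) (relation_of (\<subseteq>) (proper_ideals n))
    (N_ideal n)"
proof -
  have "N_ord n = relation_of (N_le n) (N_set n)"
    by (auto simp: N_ord_def relation_of_def)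
  then show ?thesis
    using poset_iso_relation_ofI[OF bij_betw_N_ideal]
    by (simp add: N_le_iff_N_ideal_subset)
qed

section \<open>The map \<open>\<nu>\<close>\<close>

lemma J_set_eq:
  assumes "a \<in> M_set n"
  shows "J_set n a = M_ideal n a - {(1, 1)}"
proof -
  have "(n, n) \<notin> M_ideal n a"
    using proper_ideal.top_not_mem[OF proper_ideal_M_ideal[OF assms]] .
  then show ?thesis
    by (auto simp: J_set_def P_set_def M_ideal_def triangle_def)
qed

lemma max_offdiag_eq:
  assumes "a \<in> M_set n"
  shows "max_offdiag n a = offdiag_corners (M_ideal n a)"
proof -
  have "P_le = (\<le>)"
    by (simp add: fun_eq_iff P_le_def less_eq_prod_def)
  moreover have "\<not> (r, s) \<le> (1, 1)" if "(r, s) \<in> M_ideal n a" "r < s" for r s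
    using that by (auto simp: M_ideal_def triangle_def)
  ultimately have "(\<forall>q\<in>J_set n a. P_le (r, s) q \<longrightarrow> q = (r, s)) \<longleftrightarrow>
      (\<forall>q\<in>M_ideal n a. (r, s) \<le> q \<longrightarrow> q = (r, s))"
    if "(r, s) \<in> M_ideal n a" "r < s" for r s
    using that unfolding J_set_eq[OF assms] by (metis DiffD1 DiffI singletonD)
  then show ?thesis
    by (auto simp: max_offdiag_def offdiag_corners_def J_set_eq[OF assms])
qed

lemma kappa_eq:
  assumes "a \<in> M_set n"
  shows "kappa n a = diag_length (M_ideal n a)"
proof -
  interpret proper_ideal n "M_ideal n a"
    using assms by (rule proper_ideal_M_ideal)
  let ?k = "diag_length (M_ideal n a)"
  have diag: "(i, i) \<in> J_set n a \<longleftrightarrow> i \<in> {2..?k}" for i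
    by (auto simp: J_set_eq[OF assms] diag_mem_iff)
  show ?thesis
  proof (cases "2 \<le> ?k")
    case True
    then have "Max {2..?k} = ?k"
      by (intro Max_eqI) auto
    then show ?thesis
      using True by (auto simp: kappa_def diag simp del: atLeastAtMost_iff)
  next
    case False
    then show ?thesis
      using diag_length_ge_1 by (simp add: kappa_def diag)
  qed
qed

lemma nu_eq_ideal_column:
  assumes "a \<in> M_set n"
  shows "nu n a = ideal_column (M_ideal n a)"
  by (simp add: nu_def ideal_column_def kappa_eq[OF assms] max_offdiag_eq[OF assms])

lemma nu_in_N_set:
  assumes "a \<in> M_set n"
  shows "nu n a \<in> N_set n"
  using proper_ideal.ideal_column_in_N_set[OF proper_ideal_M_ideal[OF assms]]
  by (simp add: nu_eq_ideal_column[OF assms])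

lemma N_ideal_nu:
  assumes "a \<in> M_set n"
  shows "N_ideal n (nu n a) = M_ideal n a"
  using proper_ideal.N_ideal_ideal_column[OF proper_ideal_M_ideal[OF assms]]
  by (simp add: nu_eq_ideal_column[OF assms])

theorem theorem6p5:
  fixes n :: nat
  assumes "n \<ge> 2"
  shows "(\<forall>a\<in>M_set n. pbw_column n (nu n a)) \<and>
         poset_iso (M_set n) (M_ord n) (N_set n) (N_ord n) (nu n)"
proof (intro conjI ballI)
  fix a assume "a \<in> M_set n"
  then show "pbw_column n (nu n a)"
    using nu_in_N_set by (simp add: N_set_def)
next
  show "poset_iso (M_set n) (M_ord n) (N_set n) (N_ord n) (nu n)"
    using poset_iso_M_ideal poset_iso_N_ideal nu_in_N_set N_ideal_nu by (rule poset_iso_factor)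
qed

end
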